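(* Let $(M,Q)$ be a couple of real random variables such that $$\mathbb{P}(Q\geq 0,\ 0\leq M\leq 1)=1,\qquad \mathbb{P}(M<1)>0,$$ and assume that there is $v_Q\in(0,+\infty]$ such that $\mathbb{E}(e^{vQ})<+\infty$ if $v<v_Q$ and $\mathbb{E}(e^{vQ})=+\infty$ if $v>v_Q$. Let $((M_n,Q_n))_{n\geq 0}$ be a sequence of independent and identically distributed random vectors with the same law as $(M,Q)$, and let $R_0$ be a random variable independent of $((M_n,Q_n))_{n\geq 0}$ which is non-negative and has all its exponential moments finite (that is, $\mathbb{E}(e^{vR_0})<+\infty$ for every $v\in\mathbb{R}$). Define $(R_n)_{n\geq 0}$ by $R_{n+1}=M_nR_n+Q_n$ for $n\geq 0$, and let $R$ be the (unique in law) solution of the distributional equation $$R\overset{\mathcal{L}}{=}MR+Q,\qquad R \text{ independent of } (M,Q).$$ Set $$v_c=\min\Big(v_Q,\ \sup\{v\geq 0:\ \mathbb{E}(e^{vQ}\mathbf{1}_{\{M=1\}})<1\}\Big).$$ Then for any $v<v_c$, $$\sup_{n\geq 0}\mathbb{E}(e^{vR_n})<+\infty\quad\text{and}\quad \mathbb{E}(e^{vR})<+\infty .$$ Moreover, for any $v>v_c$, $$\sup_{n\geq 0}\mathbb{E}(e^{vR_n})=+\infty\quad\text{and}\quad \mathbb{E}(e^{vR})=+\infty .$$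
   Context: All random variables are real-valued and defined on a probability space $(\Omega,\mathcal{A},\mathbb{P})$; $\overset{\mathcal{L}}{=}$ denotes equality in law. The components $M$ and $Q$ of the couple $(M,Q)$ are not assumed independent of each other. The supremum in the definition of $v_c$ and the value $v_Q$ may be $+\infty$. *)

theory Defs
  imports "HOL-Probability.Probability"
begin

definition exp_moment :: "'a measure \<Rightarrow> ('a \<Rightarrow> real) \<Rightarrow> real \<Rightarrow> ennreal" where
  "exp_moment P X v = (\<integral>\<^sup>+\<omega>. ennreal (exp (v * X \<omega>)) \<partial>P)"

(* The library's indep_var forces both variables to take values in the same type;
   this is the same notion (cf. prob_space.indep_var_eq) without that restriction. *)
definition indep_rvs ::
    "'a measure \<Rightarrow> 'b measure \<Rightarrow> ('a \<Rightarrow> 'b) \<Rightarrow> 'c measure \<Rightarrow> ('a \<Rightarrow> 'c) \<Rightarrow> bool" where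
  "indep_rvs P S X T Y \<longleftrightarrow>
     X \<in> measurable P S \<and> Y \<in> measurable P T \<and>
     prob_space.indep_set P
       (sigma_sets (space P) {X -` A \<inter> space P | A. A \<in> sets S})
       (sigma_sets (space P) {Y -` A \<inter> space P | A. A \<in> sets T})"

definition solves_perpetuity ::
    "'a measure \<Rightarrow> ('a \<Rightarrow> real) \<Rightarrow> ('a \<Rightarrow> real) \<Rightarrow> ('a \<Rightarrow> real) \<Rightarrow> bool" where
  "solves_perpetuity P M Q R \<longleftrightarrow>
     indep_rvs P borel R (borel \<Otimes>\<^sub>M borel) (\<lambda>\<omega>. (M \<omega>, Q \<omega>)) \<and>
     distr P borel R = distr P borel (\<lambda>\<omega>. M \<omega> * R \<omega> + Q \<omega>)"

definition crit_exponent ::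
    "'a measure \<Rightarrow> ('a \<Rightarrow> real) \<Rightarrow> ('a \<Rightarrow> real) \<Rightarrow> ereal \<Rightarrow> ereal" where
  "crit_exponent P M Q v\<^sub>Q =
     min v\<^sub>Q
       (SUP v \<in> {v::real. 0 \<le> v \<and>
          (\<integral>\<^sup>+\<omega>. ennreal (exp (v * Q \<omega>)) * indicator {\<omega> \<in> space P. M \<omega> = 1} \<omega> \<partial>P) < 1}.
        ereal v)"

end

theory Submission
  imports Defs
begin

text \<open>
  Write \<open>step f r = E f(M r + Q)\<close> for the transition operator of the Markov chain \<open>R\<^sub>n\<close>. By independence,
  \<open>E f(R\<^sub>n) = E (step\<^sup>n f)(R\<^sub>0)\<close>, and \<open>E f(R) = E (step\<^sup>n f)(R)\<close> for every solution \<open>R\<close> and every \<open>n\<close>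
  (\<open>nn_integral_chain\<close>, \<open>nn_integral_stationary\<close>). Every claim thus becomes an estimate of
  \<open>step\<^sup>n e\<close> for the function \<open>e(r) = exp(v r)\<close> on the half-line \<open>r \<ge> 0\<close>, which the map
  \<open>r \<mapsto> M r + Q\<close> preserves. Put \<open>g(v) = E(exp(v Q); M = 1)\<close>.

  Above the critical exponent, \<open>step e \<ge> e + P(M < 1)\<close> on \<open>r \<ge> 0\<close>: either \<open>E exp(v Q) = \<infinity>\<close> and
  \<open>step e = \<infinity>\<close>, or \<open>g(v) \<ge> 1\<close>, in which case the event \<open>M = 1\<close> alone reproduces \<open>e(r)\<close> and the event
  \<open>M < 1\<close> contributes at least its probability. Iterating, \<open>step\<^sup>n e \<ge> n P(M < 1)\<close>, so both the supremum over
  \<open>n\<close> and the moment of a solution are infinite (\<open>step_funpow_lower_drift\<close>).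

  Below the critical exponent, \<open>g(v) < 1\<close> and \<open>E exp(v Q) < \<infinity>\<close>. For \<open>v \<le> 0\<close> all moments in
  question are at most \<open>1\<close>. For \<open>v > 0\<close>, if \<open>M\<close> stays away from \<open>1\<close>, then
  \<open>exp(v M r)\<close> is negligible against \<open>exp(v r)\<close> for large \<open>r\<close>, while the part of \<open>E exp(v Q)\<close> carried by
  values of \<open>M\<close> close to \<open>1\<close> is close to \<open>g(v)\<close>. This gives the Foster-Lyapunov inequality
  \<open>step e \<le> b e + (1 - b) B\<close> with some \<open>b < 1\<close> (\<open>upper_drift_exp\<close>), hence \<open>step\<^sup>n e \<le> e + B\<close>, which
  settles \<open>R\<^sub>n\<close>.

  For a solution \<open>R\<close> the drift inequality says nothing as long as \<open>E exp(v R)\<close> may be infinite.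
  Here contraction in mean helps: \<open>step\<close> multiplies Lipschitz constants by \<open>E M < 1\<close>, so for a bounded
  Lipschitz \<open>f\<close> the function \<open>step\<^sup>n f\<close> flattens out as \<open>n\<close> grows and \<open>E f(R)\<close> is at most
  \<open>sup\<^sub>n (step\<^sup>n f)(0)\<close> (\<open>stationary_le_of_orbit_bound\<close>). Truncations of \<open>e\<close> are such functions and are
  subject to the bound \<open>step\<^sup>n e (0) \<le> 1 + B\<close>, uniformly in the truncation level; monotone
  convergence finishes the proof. The same principle, applied to a truncated negative part, shows
  that every solution is almost surely non-negative.
\<close>

section \<open>Integrating out independent variables\<close>

lemma (in prob_space) nn_integral_indep_rvs:
  assumes ind: "indep_rvs M S X T Y"
    and F: "F \<in> borel_measurable (S \<Otimes>\<^sub>M T)"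
  shows "(\<integral>\<^sup>+\<omega>. F (X \<omega>, Y \<omega>) \<partial>M) = (\<integral>\<^sup>+\<omega>. (\<integral>\<^sup>+\<omega>'. F (X \<omega>, Y \<omega>') \<partial>M) \<partial>M)"
proof -
  note [measurable] = F
  have X [measurable]: "X \<in> measurable M S" and Y [measurable]: "Y \<in> measurable M T"
    and I: "indep_set (sigma_sets (space M) {X -` A \<inter> space M | A. A \<in> sets S})
                      (sigma_sets (space M) {Y -` A \<inter> space M | A. A \<in> sets T})"
    using ind by (auto simp: indep_rvs_def)
  interpret DX: prob_space "distr M S X" by (rule prob_space_distr) simp
  interpret DY: prob_space "distr M T Y" by (rule prob_space_distr) simp
  have law: "distr M S X \<Otimes>\<^sub>M distr M T Y = distr M (S \<Otimes>\<^sub>M T) (\<lambda>\<omega>. (X \<omega>, Y \<omega>))"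
  proof (rule pair_measure_eqI)
    fix A B assume A: "A \<in> sets (distr M S X)" and B: "B \<in> sets (distr M T Y)"
    have "prob ((X -` A \<inter> space M) \<inter> (Y -` B \<inter> space M)) =
        prob (X -` A \<inter> space M) * prob (Y -` B \<inter> space M)"
      using A B by (intro indep_setD[OF I] sigma_sets.Basic) auto
    moreover have "(\<lambda>\<omega>. (X \<omega>, Y \<omega>)) -` (A \<times> B) \<inter> space M =
        (X -` A \<inter> space M) \<inter> (Y -` B \<inter> space M)" by auto
    ultimately show "emeasure (distr M S X) A * emeasure (distr M T Y) B =
        emeasure (distr M (S \<Otimes>\<^sub>M T) (\<lambda>\<omega>. (X \<omega>, Y \<omega>))) (A \<times> B)"
      using A B by (simp add: emeasure_distr emeasure_eq_measure ennreal_mult)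
  qed (auto intro: DX.sigma_finite_measure_axioms DY.sigma_finite_measure_axioms)
  have "(\<integral>\<^sup>+\<omega>. F (X \<omega>, Y \<omega>) \<partial>M) = (\<integral>\<^sup>+z. F z \<partial>distr M (S \<Otimes>\<^sub>M T) (\<lambda>\<omega>. (X \<omega>, Y \<omega>)))"
    by (simp add: nn_integral_distr)
  also have "\<dots> = (\<integral>\<^sup>+x. (\<integral>\<^sup>+y. F (x, y) \<partial>distr M T Y) \<partial>distr M S X)"
    unfolding law[symmetric] by (rule DY.nn_integral_fst[symmetric]) simp
  also have "\<dots> = (\<integral>\<^sup>+\<omega>. (\<integral>\<^sup>+y. F (X \<omega>, y) \<partial>distr M T Y) \<partial>M)"
    by (rule nn_integral_distr) (auto intro!: DY.borel_measurable_nn_integral)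
  also have "\<dots> = (\<integral>\<^sup>+\<omega>. (\<integral>\<^sup>+\<omega>'. F (X \<omega>, Y \<omega>') \<partial>M) \<partial>M)"
    by (intro nn_integral_cong nn_integral_distr)
      (auto intro!: measurable_Pair2[OF F] dest: measurable_space[OF X])
  finally show ?thesis .
qed

section \<open>The transition operator\<close>

text \<open>The recursion as a deterministic function of its start and of the sequence of coefficient pairs,
  so that randomness enters only through the law of that sequence.\<close>

primrec affine_orbit :: "real \<Rightarrow> (nat \<Rightarrow> real \<times> real) \<Rightarrow> nat \<Rightarrow> real" where
  "affine_orbit r x 0 = r"
| "affine_orbit r x (Suc n) = fst (x n) * affine_orbit r x n + snd (x n)"

lemma affine_orbit_cong:
  "(\<And>k. k < n \<Longrightarrow> x k = y k) \<Longrightarrow> affine_orbit r x n = affine_orbit r y n"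
  by (induction n) auto

lemma measurable_affine_orbit:
  assumes "{..<n} \<subseteq> I"
  shows "(\<lambda>p. affine_orbit (fst p) (snd p) n) \<in>
    borel_measurable (borel \<Otimes>\<^sub>M (\<Pi>\<^sub>M i\<in>I. borel \<Otimes>\<^sub>M borel))"
  using assms
proof (induction n)
  case (Suc n)
  have n: "n \<in> I" using Suc.prems by auto
  have [measurable]: "(\<lambda>p. affine_orbit (fst p) (snd p) n) \<in>
      borel_measurable (borel \<Otimes>\<^sub>M (\<Pi>\<^sub>M i\<in>I. borel \<Otimes>\<^sub>M borel))"
    by (rule Suc.IH) (use Suc.prems in auto)
  have [measurable]: "(\<lambda>p. snd p n) \<in>
      measurable (borel \<Otimes>\<^sub>M (\<Pi>\<^sub>M i\<in>I. borel \<Otimes>\<^sub>M borel)) (borel \<Otimes>\<^sub>M (borel :: real measure))"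
    using n by (intro measurable_compose[OF measurable_snd measurable_component_singleton])
  show ?case by simp
qed simp

locale contractive_perpetuity = prob_space P for P :: "'a measure" +
  fixes M Q :: "'a \<Rightarrow> real"
  assumes M_meas [measurable]: "M \<in> borel_measurable P"
    and Q_meas [measurable]: "Q \<in> borel_measurable P"
    and AE_range: "AE \<omega> in P. 0 \<le> Q \<omega> \<and> 0 \<le> M \<omega> \<and> M \<omega> \<le> 1"
    and prob_less_1: "\<P>(\<omega> in P. M \<omega> < 1) > 0"
begin

text \<open>Values in \<^typ>\<open>ennreal\<close> make the operator total, so that infinite exponential
  moments need no separate treatment.\<close>

definition step :: "(real \<Rightarrow> ennreal) \<Rightarrow> real \<Rightarrow> ennreal" where
  "step f r = (\<integral>\<^sup>+\<omega>. f (M \<omega> * r + Q \<omega>) \<partial>P)"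

lemma step_measurable [measurable]:
  assumes [measurable]: "f \<in> borel_measurable borel"
  shows "step f \<in> borel_measurable borel"
  unfolding step_def by measurable

lemma step_funpow_measurable [measurable]:
  "f \<in> borel_measurable borel \<Longrightarrow> (step ^^ n) f \<in> borel_measurable borel"
  by (induction n) auto

text \<open>Only the values on the half-line count, because almost surely \<open>M r + Q \<ge> 0\<close> for \<open>r \<ge> 0\<close>.\<close>

lemma step_mono_nonneg:
  assumes "\<And>r. 0 \<le> r \<Longrightarrow> f r \<le> g r" and "0 \<le> r"
  shows "step f r \<le> step g r"
  unfolding step_def
proof (rule nn_integral_mono_AE)
  show "AE \<omega> in P. f (M \<omega> * r + Q \<omega>) \<le> g (M \<omega> * r + Q \<omega>)"
    using AE_range by eventually_elim (use assms in simp)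
qed

lemma nn_integral_step:
  assumes ind: "indep_rvs P borel R (borel \<Otimes>\<^sub>M borel) (\<lambda>\<omega>. (M \<omega>, Q \<omega>))"
    and [measurable]: "f \<in> borel_measurable borel"
  shows "(\<integral>\<^sup>+\<omega>. f (M \<omega> * R \<omega> + Q \<omega>) \<partial>P) = (\<integral>\<^sup>+\<omega>. step f (R \<omega>) \<partial>P)"
  using nn_integral_indep_rvs[OF ind, of "\<lambda>p. f (fst (snd p) * fst p + snd (snd p))"]
  by (simp add: step_def)

lemma nn_integral_stationary:
  assumes R: "solves_perpetuity P M Q R" and f [measurable]: "f \<in> borel_measurable borel"
  shows "(\<integral>\<^sup>+\<omega>. f (R \<omega>) \<partial>P) = (\<integral>\<^sup>+\<omega>. (step ^^ n) f (R \<omega>) \<partial>P)"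
  using f
proof (induction n arbitrary: f)
  case (Suc n)
  note [measurable] = Suc.prems
  have ind: "indep_rvs P borel R (borel \<Otimes>\<^sub>M borel) (\<lambda>\<omega>. (M \<omega>, Q \<omega>))"
    and law: "distr P borel R = distr P borel (\<lambda>\<omega>. M \<omega> * R \<omega> + Q \<omega>)"
    using R by (auto simp: solves_perpetuity_def)
  have [measurable]: "R \<in> borel_measurable P" using ind by (simp add: indep_rvs_def)
  have "(\<integral>\<^sup>+\<omega>. f (R \<omega>) \<partial>P) = (\<integral>\<^sup>+x. f x \<partial>distr P borel R)"
    by (simp add: nn_integral_distr)
  also have "\<dots> = (\<integral>\<^sup>+\<omega>. f (M \<omega> * R \<omega> + Q \<omega>) \<partial>P)"
    unfolding law by (simp add: nn_integral_distr)
  also have "\<dots> = (\<integral>\<^sup>+\<omega>. step f (R \<omega>) \<partial>P)"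
    by (rule nn_integral_step[OF ind]) simp
  also have "\<dots> = (\<integral>\<^sup>+\<omega>. (step ^^ Suc n) f (R \<omega>) \<partial>P)"
    by (subst Suc.IH) (simp_all add: funpow_swap1)
  finally show ?case .
qed simp

text \<open>Integrating out the last coefficient pair, on which the orbit up to time \<open>n\<close> does not depend,
  replaces \<open>f\<close> by \<open>step f\<close> and shortens the orbit by one step.\<close>

lemma nn_integral_affine_orbit:
  assumes "f \<in> borel_measurable borel"
  shows "(\<integral>\<^sup>+x. f (affine_orbit r x n)
      \<partial>(\<Pi>\<^sub>M i\<in>{..<n}. distr P (borel \<Otimes>\<^sub>M borel) (\<lambda>\<omega>. (M \<omega>, Q \<omega>)))) = (step ^^ n) f r"
  using assms
proof (induction n arbitrary: f)
  case 0
  then show ?case by (simp add: nn_integral_count_space_finite PiM_empty)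
next
  case (Suc n)
  note [measurable] = Suc.prems
  let ?\<mu> = "distr P (borel \<Otimes>\<^sub>M borel) (\<lambda>\<omega>. (M \<omega>, Q \<omega>))"
  interpret \<mu>: prob_space ?\<mu> by (rule prob_space_distr) simp
  interpret product_sigma_finite "\<lambda>_::nat. ?\<mu>" ..
  have orb: "(\<lambda>x. affine_orbit r x k) \<in> borel_measurable (\<Pi>\<^sub>M i\<in>I. ?\<mu>)" if "{..<k} \<subseteq> I" for k I
    using measurable_compose[OF _ measurable_affine_orbit[OF that], of "\<lambda>x. (r, x)" "\<Pi>\<^sub>M i\<in>I. ?\<mu>"]
    by (simp cong: measurable_cong_sets sets_PiM_cong)
  have "(\<integral>\<^sup>+x. f (affine_orbit r x (Suc n)) \<partial>(\<Pi>\<^sub>M i\<in>{..<Suc n}. ?\<mu>)) =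
      (\<integral>\<^sup>+x. (\<integral>\<^sup>+y. f (affine_orbit r (x(n := y)) (Suc n)) \<partial>?\<mu>) \<partial>(\<Pi>\<^sub>M i\<in>{..<n}. ?\<mu>))"
    unfolding lessThan_Suc
    by (rule product_nn_integral_insert) (auto intro!: measurable_compose[OF orb] simp del: affine_orbit.simps)
  also have "\<dots> = (\<integral>\<^sup>+x. step f (affine_orbit r x n) \<partial>(\<Pi>\<^sub>M i\<in>{..<n}. ?\<mu>))"
  proof (intro nn_integral_cong)
    fix x
    have "affine_orbit r (x(n := y)) n = affine_orbit r x n" for y
      by (rule affine_orbit_cong) simp
    then show "(\<integral>\<^sup>+y. f (affine_orbit r (x(n := y)) (Suc n)) \<partial>?\<mu>) = step f (affine_orbit r x n)"
      by (simp add: nn_integral_distr step_def)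
  qed
  also have "\<dots> = (step ^^ Suc n) f r"
    by (subst Suc.IH) (simp_all add: funpow_swap1)
  finally show ?case .
qed

text \<open>The initial value is independent of the whole coefficient sequence, so it can be frozen; what
  remains is an orbit driven by an i.i.d. sequence, whose law is a product measure.\<close>

lemma nn_integral_chain:
  assumes ind: "indep_vars (\<lambda>_. borel \<Otimes>\<^sub>M borel) (\<lambda>n \<omega>. (Ms n \<omega>, Qs n \<omega>)) UNIV"
    and law: "\<And>n. distr P (borel \<Otimes>\<^sub>M borel) (\<lambda>\<omega>. (Ms n \<omega>, Qs n \<omega>)) =
              distr P (borel \<Otimes>\<^sub>M borel) (\<lambda>\<omega>. (M \<omega>, Q \<omega>))"
    and ind0: "indep_rvs P borel R0 (\<Pi>\<^sub>M n\<in>UNIV. borel \<Otimes>\<^sub>M borel) (\<lambda>\<omega> n. (Ms n \<omega>, Qs n \<omega>))"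
    and Rs0: "\<And>\<omega>. \<omega> \<in> space P \<Longrightarrow> Rs 0 \<omega> = R0 \<omega>"
    and RsS: "\<And>n \<omega>. \<omega> \<in> space P \<Longrightarrow> Rs (Suc n) \<omega> = Ms n \<omega> * Rs n \<omega> + Qs n \<omega>"
    and f [measurable]: "f \<in> borel_measurable borel"
  shows "(\<integral>\<^sup>+\<omega>. f (Rs n \<omega>) \<partial>P) = (\<integral>\<^sup>+\<omega>. (step ^^ n) f (R0 \<omega>) \<partial>P)"
proof -
  let ?X = "\<lambda>n \<omega>. (Ms n \<omega>, Qs n \<omega>)"
  have rv [measurable]: "?X k \<in> measurable P (borel \<Otimes>\<^sub>M borel)" for k
    using ind by (auto simp: indep_vars_def)
  have Rs: "Rs n \<omega> = affine_orbit (R0 \<omega>) (\<lambda>k. ?X k \<omega>) n" if "\<omega> \<in> space P" for \<omega>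
    using that by (induction n) (auto simp: Rs0 RsS)
  have inner: "(\<integral>\<^sup>+\<omega>. f (affine_orbit r (\<lambda>k. ?X k \<omega>) n) \<partial>P) = (step ^^ n) f r" for r
  (* The description of the law as a product measure requires a nonempty index set. *)
  proof (cases "n = 0")
    case True
    then show ?thesis by (simp add: emeasure_space_1)
  next
    case False
    have "distr P (\<Pi>\<^sub>M i\<in>{..<n}. borel \<Otimes>\<^sub>M borel) (\<lambda>\<omega>. \<lambda>i\<in>{..<n}. ?X i \<omega>) =
        (\<Pi>\<^sub>M i\<in>{..<n}. distr P (borel \<Otimes>\<^sub>M borel) (?X i))"
      using False by (intro indep_vars_iff_distr_eq_PiM[THEN iffD1, OF _ _ indep_vars_subset[OF ind]]) auto
    also have "\<dots> = (\<Pi>\<^sub>M i\<in>{..<n}. distr P (borel \<Otimes>\<^sub>M borel) (\<lambda>\<omega>. (M \<omega>, Q \<omega>)))"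
      by (simp add: law)
    finally have D: "distr P (\<Pi>\<^sub>M i\<in>{..<n}. borel \<Otimes>\<^sub>M borel) (\<lambda>\<omega>. \<lambda>i\<in>{..<n}. ?X i \<omega>) =
        (\<Pi>\<^sub>M i\<in>{..<n}. distr P (borel \<Otimes>\<^sub>M borel) (\<lambda>\<omega>. (M \<omega>, Q \<omega>)))" .
    have orb: "(\<lambda>x. affine_orbit r x n) \<in> borel_measurable (\<Pi>\<^sub>M i\<in>{..<n}. borel \<Otimes>\<^sub>M borel)"
      using measurable_compose[OF _ measurable_affine_orbit[OF order_refl], of "\<lambda>x. (r, x)"] by simp
    have "(\<integral>\<^sup>+\<omega>. f (affine_orbit r (\<lambda>k. ?X k \<omega>) n) \<partial>P) =
        (\<integral>\<^sup>+\<omega>. f (affine_orbit r (\<lambda>i\<in>{..<n}. ?X i \<omega>) n) \<partial>P)"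
      by (intro nn_integral_cong arg_cong[where f = f] affine_orbit_cong) simp
    also have "\<dots> = (\<integral>\<^sup>+x. f (affine_orbit r x n)
        \<partial>distr P (\<Pi>\<^sub>M i\<in>{..<n}. borel \<Otimes>\<^sub>M borel) (\<lambda>\<omega>. \<lambda>i\<in>{..<n}. ?X i \<omega>))"
      using orb by (subst nn_integral_distr) auto
    finally show ?thesis unfolding D by (simp add: nn_integral_affine_orbit)
  qed
  have "(\<integral>\<^sup>+\<omega>. f (Rs n \<omega>) \<partial>P) = (\<integral>\<^sup>+\<omega>. f (affine_orbit (R0 \<omega>) (\<lambda>k. ?X k \<omega>) n) \<partial>P)"
    by (intro nn_integral_cong) (simp add: Rs)
  also have "\<dots> = (\<integral>\<^sup>+\<omega>. (\<integral>\<^sup>+\<omega>'. f (affine_orbit (R0 \<omega>) (\<lambda>k. ?X k \<omega>') n) \<partial>P) \<partial>P)"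
    using nn_integral_indep_rvs[OF ind0, of "\<lambda>p. f (affine_orbit (fst p) (snd p) n)"]
      measurable_compose[OF measurable_affine_orbit f] by simp
  finally show ?thesis by (simp only: inner)
qed

section \<open>Contraction in mean and stationary laws\<close>

lemma M_integrable: "integrable P M"
  using AE_range by (intro integrable_const_bound[where B = 1]) auto

lemma expectation_M_nonneg: "0 \<le> expectation M"
  using AE_range by (intro integral_nonneg_AE) auto

lemma not_AE_ge_1: "\<not> (AE \<omega> in P. 1 \<le> M \<omega>)"
proof
  assume "AE \<omega> in P. 1 \<le> M \<omega>"
  then have "\<P>(\<omega> in P. M \<omega> < 1) = 0"
    by (intro prob_eq_0_AE) (auto simp: not_less)
  with prob_less_1 show False by simp
qed

lemma expectation_M_less_1: "expectation M < 1"
proof -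
  have le: "expectation M \<le> 1"
    using AE_range M_integrable by (intro integral_le_const) auto
  have "expectation M \<noteq> 1"
  proof
    assume "expectation M = 1"
    then have "expectation (\<lambda>\<omega>. 1 - M \<omega>) = 0"
      using M_integrable by (simp add: prob_space)
    then have "AE \<omega> in P. 1 - M \<omega> = 0"
      using AE_range M_integrable by (subst (asm) integral_nonneg_eq_0_iff_AE) auto
    then have "AE \<omega> in P. 1 \<le> M \<omega>" by eventually_elim simp
    then show False using not_AE_ge_1 by simp
  qed
  with le show ?thesis by simp
qed

lemma step_le_const:
  assumes "\<And>r. f r \<le> N"
  shows "step f r \<le> N"
proof -
  have "step f r \<le> (\<integral>\<^sup>+\<omega>. N \<partial>P)"
    unfolding step_def by (intro nn_integral_mono assms)
  then show ?thesis by (simp add: emeasure_space_1)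
qed

lemma step_funpow_le_const:
  "(\<And>r. f r \<le> N) \<Longrightarrow> (step ^^ n) f r \<le> N"
  by (induction n arbitrary: r) (auto intro: step_le_const)

text \<open>Two copies of the chain driven by the same pair \<open>(M, Q)\<close> differ after one step by \<open>M (x - y)\<close>,
  since \<open>Q\<close> cancels.\<close>

lemma step_contraction:
  assumes [measurable]: "f \<in> borel_measurable borel"
    and lip: "\<And>x y. f x \<le> f y + ennreal (L * \<bar>x - y\<bar>)" and L: "0 \<le> L"
  shows "step f x \<le> step f y + ennreal (L * expectation M * \<bar>x - y\<bar>)"
proof -
  have "step f x \<le> (\<integral>\<^sup>+\<omega>. f (M \<omega> * y + Q \<omega>) + ennreal (L * \<bar>x - y\<bar> * M \<omega>) \<partial>P)"
    unfolding step_def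
  proof (rule nn_integral_mono_AE)
    show "AE \<omega> in P. f (M \<omega> * x + Q \<omega>) \<le> f (M \<omega> * y + Q \<omega>) + ennreal (L * \<bar>x - y\<bar> * M \<omega>)"
      using AE_range
    proof eventually_elim
      case (elim \<omega>)
      have "M \<omega> * x + Q \<omega> - (M \<omega> * y + Q \<omega>) = M \<omega> * (x - y)" by (simp add: algebra_simps)
      then show ?case
        using lip[of "M \<omega> * x + Q \<omega>" "M \<omega> * y + Q \<omega>"] elim
        by (simp add: abs_mult mult_ac)
    qed
  qed
  also have "\<dots> = step f y + (\<integral>\<^sup>+\<omega>. ennreal (L * \<bar>x - y\<bar> * M \<omega>) \<partial>P)"
    unfolding step_def by (rule nn_integral_add) auto
  also have "(\<integral>\<^sup>+\<omega>. ennreal (L * \<bar>x - y\<bar> * M \<omega>) \<partial>P) = ennreal (expectation (\<lambda>\<omega>. L * \<bar>x - y\<bar> * M \<omega>))"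
    using AE_range L M_integrable by (intro nn_integral_eq_integral) auto
  finally show ?thesis by (simp add: mult_ac)
qed

lemma step_funpow_contraction:
  assumes f [measurable]: "f \<in> borel_measurable borel"
    and lip: "\<And>x y. f x \<le> f y + ennreal (L * \<bar>x - y\<bar>)" and L: "0 \<le> L"
  shows "(step ^^ n) f x \<le> (step ^^ n) f y + ennreal (L * expectation M ^ n * \<bar>x - y\<bar>)"
proof (induction n arbitrary: x y)
  case (Suc n)
  have "step ((step ^^ n) f) x \<le>
      step ((step ^^ n) f) y + ennreal (L * expectation M ^ n * expectation M * \<bar>x - y\<bar>)"
    using Suc L expectation_M_nonneg by (intro step_contraction) auto
  then show ?case by (simp add: mult_ac)
qed (use lip in simp)

text \<open>This replaces convergence in law of the chain to its stationary law: \<open>E f(R) = E (step\<^sup>n f)(R)\<close>,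
  and \<open>(step\<^sup>n f)(R)\<close> exceeds \<open>(step\<^sup>n f)(0)\<close> by at most \<open>min(N, L (E M)\<^sup>n \<bar>R\<bar>)\<close>, whose expectation tends to
  zero without any moment assumption on \<open>R\<close>.\<close>

lemma stationary_le_of_orbit_bound:
  assumes R: "solves_perpetuity P M Q R"
    and f [measurable]: "f \<in> borel_measurable borel"
    and lip: "\<And>x y. f x \<le> f y + ennreal (L * \<bar>x - y\<bar>)" and L: "0 \<le> L"
    and bounded: "\<And>x. f x \<le> ennreal N"
    and orbit: "\<And>n. (step ^^ n) f 0 \<le> B"
  shows "(\<integral>\<^sup>+\<omega>. f (R \<omega>) \<partial>P) \<le> B"
proof -
  have [measurable]: "R \<in> borel_measurable P"
    using R by (simp add: solves_perpetuity_def indep_rvs_def)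
  let ?\<rho> = "expectation M"
  let ?u = "\<lambda>n \<omega>. min (ennreal N) (ennreal (L * ?\<rho> ^ n * \<bar>R \<omega>\<bar>))"
  have bound: "(\<integral>\<^sup>+\<omega>. f (R \<omega>) \<partial>P) \<le> B + (\<integral>\<^sup>+\<omega>. ?u n \<omega> \<partial>P)" for n
  proof -
    have "(\<integral>\<^sup>+\<omega>. f (R \<omega>) \<partial>P) = (\<integral>\<^sup>+\<omega>. (step ^^ n) f (R \<omega>) \<partial>P)"
      by (rule nn_integral_stationary[OF R]) simp
    also have "\<dots> \<le> (\<integral>\<^sup>+\<omega>. B + ?u n \<omega> \<partial>P)"
    proof (rule nn_integral_mono)
      fix \<omega>
      have "(step ^^ n) f (R \<omega>) \<le> B + ennreal (L * ?\<rho> ^ n * \<bar>R \<omega>\<bar>)"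
        using step_funpow_contraction[OF f lip L, where n = n and x = "R \<omega>" and y = 0] orbit[of n]
        by (auto intro: order_trans add_right_mono)
      moreover have "(step ^^ n) f (R \<omega>) \<le> B + ennreal N"
        using step_funpow_le_const[OF bounded, where n = n and r = "R \<omega>"] by (simp add: add_increasing)
      ultimately show "(step ^^ n) f (R \<omega>) \<le> B + ?u n \<omega>"
        by (simp add: min_def)
    qed
    also have "\<dots> = B + (\<integral>\<^sup>+\<omega>. ?u n \<omega> \<partial>P)"
      by (subst nn_integral_add) (auto simp: emeasure_space_1)
    finally show ?thesis .
  qed
  have "(\<lambda>n. \<integral>\<^sup>+\<omega>. ?u n \<omega> \<partial>P) \<longlonglongrightarrow> (\<integral>\<^sup>+\<omega>. 0 \<partial>P)"
  proof (rule nn_integral_dominated_convergence[where w = "\<lambda>_. ennreal N"])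
    show "AE \<omega> in P. (\<lambda>n. ?u n \<omega>) \<longlonglongrightarrow> 0"
    proof (rule AE_I2)
      fix \<omega>
      have "(\<lambda>n. L * ?\<rho> ^ n * \<bar>R \<omega>\<bar>) \<longlonglongrightarrow> L * 0 * \<bar>R \<omega>\<bar>"
        using expectation_M_nonneg expectation_M_less_1
        by (intro tendsto_intros LIMSEQ_realpow_zero)
      then have "(\<lambda>n. ennreal (L * ?\<rho> ^ n * \<bar>R \<omega>\<bar>)) \<longlonglongrightarrow> ennreal 0"
        by (intro tendsto_ennrealI) simp
      then have "(\<lambda>n. ?u n \<omega>) \<longlonglongrightarrow> min (ennreal N) (ennreal 0)"
        by (intro tendsto_min tendsto_const)
      then show "(\<lambda>n. ?u n \<omega>) \<longlonglongrightarrow> 0" by simp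
    qed
  qed (auto simp: emeasure_space_1 ennreal_mult_less_top)
  then have "(\<lambda>n. B + (\<integral>\<^sup>+\<omega>. ?u n \<omega> \<partial>P)) \<longlonglongrightarrow> B + 0"
    by (intro tendsto_add tendsto_const) simp
  then show ?thesis
    using bound by (intro LIMSEQ_le_const[of _ "B"]) auto
qed

lemma step_funpow_eq_0:
  assumes "\<And>r. 0 \<le> r \<Longrightarrow> f r = 0" and "0 \<le> r"
  shows "(step ^^ n) f r = 0"
  using assms(2)
proof (induction n arbitrary: r)
  case (Suc n)
  have "step ((step ^^ n) f) r \<le> step (\<lambda>_. 0) r"
    using Suc by (intro step_mono_nonneg) auto
  also have "\<dots> = 0" by (simp add: step_def)
  finally show ?case by simp
qed (simp add: assms)

text \<open>Started at \<open>0\<close> the chain never becomes negative, so a bounded Lipschitz function vanishing exactly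
  on the half-line has mean zero under every stationary law.\<close>

lemma stationary_nonneg:
  assumes R: "solves_perpetuity P M Q R"
  shows "AE \<omega> in P. 0 \<le> R \<omega>"
proof -
  have [measurable]: "R \<in> borel_measurable P"
    using R by (simp add: solves_perpetuity_def indep_rvs_def)
  let ?f = "\<lambda>r::real. ennreal (min 1 (max 0 (- r)))"
  have "(\<integral>\<^sup>+\<omega>. ?f (R \<omega>) \<partial>P) \<le> 0"
  proof (rule stationary_le_of_orbit_bound[OF R, where L = 1 and N = 1])
    show "?f x \<le> ?f y + ennreal (1 * \<bar>x - y\<bar>)" for x y :: real
      by (subst ennreal_plus[symmetric])
        (auto intro!: ennreal_leI simp: min_def max_def abs_real_def simp del: ennreal_plus)
    show "(step ^^ n) ?f 0 \<le> 0" for n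
      by (subst step_funpow_eq_0) auto
  qed auto
  then have "AE \<omega> in P. ?f (R \<omega>) = 0"
    by (subst nn_integral_0_iff_AE[symmetric]) auto
  then show ?thesis
    by eventually_elim (auto simp: min_def max_def split: if_splits)
qed

section \<open>Iterating drift inequalities\<close>

text \<open>\<open>B\<close> is a fixed point of \<open>w \<mapsto> b w + (1 - b) B\<close>; with the additive constant in this form the
  iterates remain convex combinations of \<open>W\<close> and \<open>B\<close>. The function \<open>f\<close> is separate from \<open>W\<close> so that
  the estimate also covers truncations of \<open>W\<close>.\<close>

lemma step_funpow_upper_drift:
  assumes [measurable]: "W \<in> borel_measurable borel"
    and W: "\<And>r. 0 \<le> W r" and b: "0 \<le> b" "b \<le> 1" and B: "0 \<le> B"
    and drift: "\<And>r. 0 \<le> r \<Longrightarrow> step (\<lambda>r. ennreal (W r)) r \<le> ennreal (b * W r + (1 - b) * B)"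
    and f: "\<And>r. 0 \<le> r \<Longrightarrow> f r \<le> ennreal (W r)" and r: "0 \<le> r"
  shows "(step ^^ n) f r \<le> ennreal (b ^ n * W r + (1 - b ^ n) * B)"
  using r
proof (induction n arbitrary: r)
  case (Suc n)
  have b': "0 \<le> b ^ n" "b ^ n \<le> 1" using b by (auto intro: power_le_one)
  have "(step ^^ Suc n) f r \<le> step (\<lambda>r. ennreal (b ^ n * W r + (1 - b ^ n) * B)) r"
    using Suc by (auto intro: step_mono_nonneg)
  also have "\<dots> = ennreal (b ^ n) * step (\<lambda>r. ennreal (W r)) r + ennreal ((1 - b ^ n) * B)"
    using b' W B unfolding step_def
    by (simp add: ennreal_plus ennreal_mult nn_integral_add nn_integral_cmult emeasure_space_1)
  also have "\<dots> \<le> ennreal (b ^ n) * ennreal (b * W r + (1 - b) * B) + ennreal ((1 - b ^ n) * B)"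
    by (intro add_right_mono mult_left_mono drift Suc.prems) simp
  also have "\<dots> = ennreal (b ^ n * (b * W r + (1 - b) * B) + (1 - b ^ n) * B)"
    using b b' W[of r] B by (simp add: ennreal_plus ennreal_mult)
  also have "b ^ n * (b * W r + (1 - b) * B) + (1 - b ^ n) * B = b ^ Suc n * W r + (1 - b ^ Suc n) * B"
    by (simp add: algebra_simps)
  finally show ?case .
qed (use f in auto)

lemma step_funpow_lower_drift:
  assumes [measurable]: "f \<in> borel_measurable borel"
    and drift: "\<And>r. 0 \<le> r \<Longrightarrow> f r + p \<le> step f r" and r: "0 \<le> r"
  shows "f r + of_nat n * p \<le> (step ^^ n) f r"
  using r
proof (induction n arbitrary: r)
  case (Suc n)
  have "f r + of_nat (Suc n) * p = (f r + p) + of_nat n * p" by (simp add: algebra_simps)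
  also have "\<dots> \<le> step f r + of_nat n * p" by (intro add_right_mono drift Suc)
  also have "\<dots> = step (\<lambda>r. f r + of_nat n * p) r"
    by (simp add: step_def nn_integral_add emeasure_space_1)
  also have "\<dots> \<le> (step ^^ Suc n) f r" using Suc by (auto intro: step_mono_nonneg)
  finally show ?case .
qed simp
end

section \<open>Exponential moments below the critical exponent\<close>

lemma exp_Lipschitz_below:
  fixes a b c :: real
  assumes "a \<le> c" "b \<le> c"
  shows "exp a \<le> exp b + exp c * \<bar>a - b\<bar>"
proof (cases "a \<le> b")
  case True
  then show ?thesis by (simp add: add_increasing2)
next
  case False
  have "exp a - exp b = exp a * (1 - exp (b - a))" by (simp add: algebra_simps exp_diff)
  also have "\<dots> \<le> exp a * (a - b)"
    using exp_ge_add_one_self[of "b - a"] by (intro mult_left_mono) (simp_all del: exp_ge_add_one_self)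
  also have "\<dots> \<le> exp c * (a - b)"
    using False assms by (intro mult_right_mono) auto
  finally show ?thesis using False by simp
qed

text \<open>If \<open>m \<le> 1 - e\<close>, then \<open>exp (m s) \<le> exp (- e s) exp s\<close>, and the factor \<open>exp (- e s)\<close> is at most
  \<open>e\<close> as soon as \<open>s \<ge> ln (1/e) / e\<close>; below this threshold \<open>exp (m s)\<close> is bounded by a constant.\<close>

lemma exp_interpolation:
  fixes m s e :: real
  assumes m: "m \<le> 1" and s: "0 \<le> s" and e: "0 < e"
  shows "exp (m * s) \<le> (indicator {1 - e<..} m + e) * exp s + exp (ln (1 / e) / e)"
proof (cases "1 - e < m")
  case True
  have "exp (m * s) \<le> exp s" using mult_right_mono[OF m s] by simp
  also have "\<dots> \<le> (1 + e) * exp s" using e by (simp add: mult_le_cancel_right1)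
  finally show ?thesis using True by (simp add: add_increasing2)
next
  case False
  show ?thesis
  proof (cases "ln (1 / e) \<le> e * s")
    case True
    have "m * s \<le> (1 - e) * s" using False s by (intro mult_right_mono) auto
    also have "\<dots> \<le> s - ln (1 / e)" using True by (simp add: algebra_simps)
    finally have "exp (m * s) \<le> exp (s - ln (1 / e))" by simp
    also have "\<dots> = e * exp s" using e by (simp add: exp_diff)
    finally show ?thesis using False by (simp add: add_increasing2)
  next
    case 2: False
    then have "s \<le> ln (1 / e) / e" using e by (simp add: field_simps)
    moreover have "m * s \<le> s" using mult_right_mono[OF m s] by simp
    ultimately have "exp (m * s) \<le> exp (ln (1 / e) / e)" by simp
    then show ?thesis using False e by (simp add: add_increasing)
  qed
qed

context contractive_perpetuity
begin

text \<open>The exponential is truncated from above inside the exponent, and its argument is cut at zero, which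
  makes it bounded and Lipschitz on the whole line. The drift bound of its orbit at \<open>0\<close> is
  independent of the truncation level.\<close>

lemma stationary_exp_moment_le:
  assumes R: "solves_perpetuity P M Q R"
    and b: "0 \<le> b" "b \<le> 1" and B: "0 \<le> B"
    and drift: "\<And>r. 0 \<le> r \<Longrightarrow>
      step (\<lambda>r. ennreal (exp (v * r))) r \<le> ennreal (b * exp (v * r) + (1 - b) * B)"
  shows "exp_moment P R v \<le> ennreal (1 + B)"
proof -
  have [measurable]: "R \<in> borel_measurable P"
    using R by (simp add: solves_perpetuity_def indep_rvs_def)
  let ?f = "\<lambda>c r. ennreal (exp (min (v * max 0 r) (real c)))"
  have trunc: "(\<integral>\<^sup>+\<omega>. ?f c (R \<omega>) \<partial>P) \<le> ennreal (1 + B)" for c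
  proof (rule stationary_le_of_orbit_bound[OF R, where L = "exp (real c) * \<bar>v\<bar>" and N = "exp (real c)"])
    show "?f c x \<le> ?f c y + ennreal (exp (real c) * \<bar>v\<bar> * \<bar>x - y\<bar>)" for x y
    proof -
      let ?a = "min (v * max 0 x) (real c)" and ?b = "min (v * max 0 y) (real c)"
      have "\<bar>min p d - min q d\<bar> \<le> \<bar>p - q\<bar>" for p q d :: real by linarith
      then have "\<bar>?a - ?b\<bar> \<le> \<bar>v * max 0 x - v * max 0 y\<bar>" .
      also have "\<dots> = \<bar>v\<bar> * \<bar>max 0 x - max 0 y\<bar>"
        by (simp add: abs_mult[symmetric] right_diff_distrib)
      also have "\<dots> \<le> \<bar>v\<bar> * \<bar>x - y\<bar>"
        by (intro mult_left_mono) (auto simp: max_def)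
      finally have dist: "\<bar>?a - ?b\<bar> \<le> \<bar>v\<bar> * \<bar>x - y\<bar>" .
      have "exp ?a \<le> exp ?b + exp (real c) * \<bar>?a - ?b\<bar>"
        by (rule exp_Lipschitz_below) simp_all
      also have "\<dots> \<le> exp ?b + exp (real c) * (\<bar>v\<bar> * \<bar>x - y\<bar>)"
        by (rule add_left_mono, rule mult_left_mono[OF dist]) simp
      finally have "?f c x \<le> ennreal (exp ?b + exp (real c) * (\<bar>v\<bar> * \<bar>x - y\<bar>))"
        by (rule ennreal_leI)
      also have "\<dots> = ?f c y + ennreal (exp (real c) * \<bar>v\<bar> * \<bar>x - y\<bar>)"
        unfolding mult.assoc by (rule ennreal_plus) simp_all
      finally show ?thesis .
    qed
    show "(step ^^ n) (?f c) 0 \<le> ennreal (1 + B)" for n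
    proof -
      have "(step ^^ n) (?f c) 0 \<le> ennreal (b ^ n * exp (v * 0) + (1 - b ^ n) * B)"
        by (rule step_funpow_upper_drift[where W = "\<lambda>r. exp (v * r)", OF _ _ b B drift])
          (simp_all add: max_def)
      also have "\<dots> \<le> ennreal (1 + B)"
        using b B by (intro ennreal_leI add_mono mult_left_le_one_le) (auto intro: power_le_one)
      finally show ?thesis .
    qed
  qed (auto intro!: ennreal_leI)
  have "exp_moment P R v \<le> (\<integral>\<^sup>+\<omega>. (SUP c. ?f c (R \<omega>)) \<partial>P)"
    unfolding exp_moment_def
  proof (rule nn_integral_mono_AE)
    show "AE \<omega> in P. ennreal (exp (v * R \<omega>)) \<le> (SUP c. ?f c (R \<omega>))"
      using stationary_nonneg[OF R]
    proof eventually_elim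
      case (elim \<omega>)
      obtain c :: nat where "v * R \<omega> \<le> real c" using real_arch_simple by blast
      then have "ennreal (exp (v * R \<omega>)) \<le> ?f c (R \<omega>)" using elim by simp
      then show ?case by (rule SUP_upper2[OF UNIV_I])
    qed
  qed
  also have "\<dots> = (SUP c. \<integral>\<^sup>+\<omega>. ?f c (R \<omega>) \<partial>P)"
    by (rule nn_integral_monotone_convergence_SUP)
      (auto simp: incseq_def le_fun_def intro!: ennreal_leI)
  also have "\<dots> \<le> ennreal (1 + B)" by (intro SUP_least trunc)
  finally show ?thesis .
qed

text \<open>By \<open>exp_interpolation\<close> with \<open>e = 1/(k+1)\<close>, the coefficient of \<open>exp (v r)\<close> in \<open>step\<close> is at most the
  mean of \<open>exp (v Q)\<close> times \<open>(1\<^bsub>M > 1 - e\<^esub> + e)\<close>. This tends to the mass \<open>E(exp (v Q); M = 1)\<close> as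
  \<open>k\<close> grows, by dominated convergence with \<open>2 exp (v Q)\<close>, and so is below \<open>1\<close> for some \<open>k\<close>.\<close>

lemma upper_drift_exp:
  assumes v: "0 < v" and fin: "exp_moment P Q v < \<infinity>"
    and slice: "(\<integral>\<^sup>+\<omega>. ennreal (exp (v * Q \<omega>)) * indicator {\<omega> \<in> space P. M \<omega> = 1} \<omega> \<partial>P) < 1"
  obtains b B where "0 \<le> b" "b < 1" "0 \<le> B"
    "\<And>r. 0 \<le> r \<Longrightarrow>
      step (\<lambda>r. ennreal (exp (v * r))) r \<le> ennreal (b * exp (v * r) + (1 - b) * B)"
proof -
  let ?e = "\<lambda>k::nat. 1 / real (Suc k)"
  let ?h = "\<lambda>k m. (indicator {1 - ?e k<..} m + ?e k :: real)"
  let ?u = "\<lambda>k \<omega>. ennreal (exp (v * Q \<omega>) * ?h k (M \<omega>))"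
  have "(\<lambda>k. \<integral>\<^sup>+\<omega>. ?u k \<omega> \<partial>P) \<longlonglongrightarrow>
      (\<integral>\<^sup>+\<omega>. ennreal (exp (v * Q \<omega>)) * indicator {\<omega> \<in> space P. M \<omega> = 1} \<omega> \<partial>P)"
  proof (rule nn_integral_dominated_convergence[where w = "\<lambda>\<omega>. 2 * ennreal (exp (v * Q \<omega>))"])
    show "AE \<omega> in P. ?u k \<omega> \<le> 2 * ennreal (exp (v * Q \<omega>))" for k
    proof (rule AE_I2)
      fix \<omega>
      have "exp (v * Q \<omega>) * ?h k (M \<omega>) \<le> exp (v * Q \<omega>) * 2"
        by (intro mult_left_mono) (auto simp: indicator_def field_simps)
      then show "?u k \<omega> \<le> 2 * ennreal (exp (v * Q \<omega>))"
        using ennreal_leI[of "exp (v * Q \<omega>) * ?h k (M \<omega>)" "exp (v * Q \<omega>) * 2"]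
        by (simp add: ennreal_mult'' mult.commute)
    qed
    show "(\<integral>\<^sup>+\<omega>. 2 * ennreal (exp (v * Q \<omega>)) \<partial>P) < \<infinity>"
      using fin by (simp add: nn_integral_cmult exp_moment_def ennreal_mult_less_top)
    show "AE \<omega> in P. (\<lambda>k. ?u k \<omega>) \<longlonglongrightarrow>
        ennreal (exp (v * Q \<omega>)) * indicator {\<omega> \<in> space P. M \<omega> = 1} \<omega>"
      using AE_range AE_space
    proof eventually_elim
      case (elim \<omega>)
      have e0: "?e \<longlonglongrightarrow> 0" using LIMSEQ_inverse_real_of_nat by (simp add: inverse_eq_divide)
      have "(\<lambda>k. indicator {1 - ?e k<..} (M \<omega>) :: real) \<longlonglongrightarrow> indicator {1} (M \<omega>)"
      proof (cases "M \<omega> = 1")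
        case True
        then show ?thesis by simp
      next
        case False
        have "eventually (\<lambda>k. ?e k < 1 - M \<omega>) sequentially"
          using False elim by (intro order_tendstoD(2)[OF e0]) auto
        then have "eventually (\<lambda>k. indicator {1 - ?e k<..} (M \<omega>) = (0 :: real)) sequentially"
          by eventually_elim (simp add: indicator_def)
        then show ?thesis using False by (simp add: tendsto_eventually)
      qed
      then have "(\<lambda>k. ?h k (M \<omega>)) \<longlonglongrightarrow> indicator {1} (M \<omega>) + 0"
        using e0 by (rule tendsto_add)
      then have "(\<lambda>k. ?u k \<omega>) \<longlonglongrightarrow> ennreal (exp (v * Q \<omega>) * (indicator {1} (M \<omega>) + 0))"
        by (intro tendsto_ennrealI tendsto_mult tendsto_const)
      moreover have "ennreal (exp (v * Q \<omega>) * (indicator {1} (M \<omega>) + 0)) =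
          ennreal (exp (v * Q \<omega>)) * indicator {\<omega> \<in> space P. M \<omega> = 1} \<omega>"
        using elim by (simp add: indicator_def)
      ultimately show ?case by (simp only:)
    qed
  qed auto
  from order_tendstoD(2)[OF this slice] obtain k where k: "(\<integral>\<^sup>+\<omega>. ?u k \<omega> \<partial>P) < 1"
    by (auto simp: eventually_sequentially)
  define K where "K = exp (ln (1 / ?e k) / ?e k)"
  define b where "b = enn2real (\<integral>\<^sup>+\<omega>. ?u k \<omega> \<partial>P)"
  define C where "C = enn2real (exp_moment P Q v)"
  have "(\<integral>\<^sup>+\<omega>. ?u k \<omega> \<partial>P) < \<top>" using k by (rule less_trans) simp
  then have b: "ennreal b = (\<integral>\<^sup>+\<omega>. ?u k \<omega> \<partial>P)" "0 \<le> b"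
    unfolding b_def by (rule ennreal_enn2real) simp
  have C: "ennreal C = exp_moment P Q v" "0 \<le> C"
    using fin by (auto simp: C_def)
  have K: "0 \<le> K" by (simp add: K_def)
  have b1: "b < 1" using k b by (metis ennreal_1 ennreal_less_iff)
  show thesis
  proof (rule that[of b "C * K / (1 - b)"])
    fix r :: real assume r: "0 \<le> r"
    have "step (\<lambda>r. ennreal (exp (v * r))) r \<le>
        (\<integral>\<^sup>+\<omega>. ?u k \<omega> * ennreal (exp (v * r)) + ennreal (exp (v * Q \<omega>)) * ennreal K \<partial>P)"
      unfolding step_def
    proof (rule nn_integral_mono_AE)
      show "AE \<omega> in P. ennreal (exp (v * (M \<omega> * r + Q \<omega>))) \<le>
          ?u k \<omega> * ennreal (exp (v * r)) + ennreal (exp (v * Q \<omega>)) * ennreal K"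
        using AE_range
      proof eventually_elim
        case (elim \<omega>)
        have h: "0 \<le> ?h k (M \<omega>)" by (simp add: indicator_def)
        have "exp (M \<omega> * (v * r)) \<le> ?h k (M \<omega>) * exp (v * r) + K"
          unfolding K_def using elim v r by (intro exp_interpolation) auto
        then have "exp (v * Q \<omega>) * exp (M \<omega> * (v * r)) \<le>
            exp (v * Q \<omega>) * (?h k (M \<omega>) * exp (v * r) + K)"
          by (intro mult_left_mono) auto
        then have "exp (v * (M \<omega> * r + Q \<omega>)) \<le>
            exp (v * Q \<omega>) * ?h k (M \<omega>) * exp (v * r) + exp (v * Q \<omega>) * K"
          by (simp add: exp_add[symmetric] algebra_simps)
        then have "ennreal (exp (v * (M \<omega> * r + Q \<omega>))) \<le>
            ennreal (exp (v * Q \<omega>) * ?h k (M \<omega>) * exp (v * r) + exp (v * Q \<omega>) * K)"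
          by (rule ennreal_leI)
        also have "\<dots> = ?u k \<omega> * ennreal (exp (v * r)) + ennreal (exp (v * Q \<omega>)) * ennreal K"
          using h K by (subst ennreal_plus) (auto simp: ennreal_mult)
        finally show ?case .
      qed
    qed
    also have "\<dots> = ennreal b * ennreal (exp (v * r)) + ennreal C * ennreal K"
      by (simp add: nn_integral_add nn_integral_multc b C exp_moment_def)
    also have "\<dots> = ennreal (b * exp (v * r) + C * K)"
      using b C K by (simp add: ennreal_plus ennreal_mult)
    also have "C * K = (1 - b) * (C * K / (1 - b))" using b1 by simp
    finally show "step (\<lambda>r. ennreal (exp (v * r))) r \<le>
        ennreal (b * exp (v * r) + (1 - b) * (C * K / (1 - b)))" .
  qed (use b b1 C K in auto)
qed

lemma upper_drift_exp_nonpos: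
  assumes "v \<le> 0" "0 \<le> r"
  shows "step (\<lambda>r. ennreal (exp (v * r))) r \<le> 1"
proof -
  have "step (\<lambda>r. ennreal (exp (v * r))) r \<le> step (\<lambda>_. 1) r"
    using assms by (intro step_mono_nonneg) (auto simp: mult_le_0_iff)
  then show ?thesis by (simp add: step_def emeasure_space_1)
qed

section \<open>Exponential moments above the critical exponent\<close>

text \<open>On \<open>M = 1\<close> the integrand factors as \<open>exp (v Q) exp (v r)\<close>; on \<open>M < 1\<close> it is at least \<open>1\<close>,
  because the exponent is non-negative.\<close>

lemma lower_drift_exp_slice:
  assumes v: "0 \<le> v" and r: "0 \<le> r"
    and slice: "1 \<le> (\<integral>\<^sup>+\<omega>. ennreal (exp (v * Q \<omega>)) * indicator {\<omega> \<in> space P. M \<omega> = 1} \<omega> \<partial>P)"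
  shows "ennreal (exp (v * r)) + ennreal \<P>(\<omega> in P. M \<omega> < 1) \<le> step (\<lambda>r. ennreal (exp (v * r))) r"
proof -
  let ?S = "{\<omega> \<in> space P. M \<omega> = 1}" and ?T = "{\<omega> \<in> space P. M \<omega> < 1}"
  have "ennreal (exp (v * r)) + ennreal \<P>(\<omega> in P. M \<omega> < 1) \<le>
      (\<integral>\<^sup>+\<omega>. ennreal (exp (v * Q \<omega>)) * indicator ?S \<omega> \<partial>P) * ennreal (exp (v * r)) + emeasure P ?T"
    using mult_right_mono[OF slice, of "ennreal (exp (v * r))"]
    by (simp add: emeasure_eq_measure add_right_mono)
  also have "\<dots> = (\<integral>\<^sup>+\<omega>. ennreal (exp (v * Q \<omega>)) * indicator ?S \<omega> * ennreal (exp (v * r)) + indicator ?T \<omega> \<partial>P)"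
    by (simp add: nn_integral_add nn_integral_multc)
  also have "\<dots> \<le> step (\<lambda>r. ennreal (exp (v * r))) r"
    unfolding step_def
  proof (rule nn_integral_mono_AE)
    show "AE \<omega> in P. ennreal (exp (v * Q \<omega>)) * indicator ?S \<omega> * ennreal (exp (v * r)) + indicator ?T \<omega>
        \<le> ennreal (exp (v * (M \<omega> * r + Q \<omega>)))"
      using AE_range
      by eventually_elim
        (use v r in \<open>auto simp: indicator_def ennreal_mult[symmetric] exp_add[symmetric] algebra_simps\<close>)
  qed
  finally show ?thesis .
qed

lemma step_exp_eq_infinity:
  assumes v: "0 \<le> v" and r: "0 \<le> r" and inf: "exp_moment P Q v = \<infinity>"
  shows "step (\<lambda>r. ennreal (exp (v * r))) r = \<infinity>"
proof -
  have "exp_moment P Q v \<le> step (\<lambda>r. ennreal (exp (v * r))) r"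
    unfolding step_def exp_moment_def
  proof (rule nn_integral_mono_AE)
    show "AE \<omega> in P. ennreal (exp (v * Q \<omega>)) \<le> ennreal (exp (v * (M \<omega> * r + Q \<omega>)))"
      using AE_range
      by eventually_elim (use v r in \<open>auto intro!: ennreal_leI mult_left_mono\<close>)
  qed
  then show ?thesis using inf by (simp add: top.extremum_unique)
qed

section \<open>What the critical exponent says about \<open>v\<close>\<close>

text \<open>The set under the supremum in the critical exponent contains \<open>0\<close>, so the critical exponent is
  non-negative.\<close>

lemma slice_at_0: "(\<integral>\<^sup>+\<omega>. ennreal (exp (0 * Q \<omega>)) * indicator {\<omega> \<in> space P. M \<omega> = 1} \<omega> \<partial>P) < 1"
proof -
  have "\<P>(\<omega> in P. M \<omega> = 1) \<noteq> 1"
  proof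
    assume "\<P>(\<omega> in P. M \<omega> = 1) = 1"
    then have "AE \<omega> in P. M \<omega> = 1" by (subst (asm) prob_Collect_eq_1) auto
    then have "AE \<omega> in P. 1 \<le> M \<omega>" by eventually_elim simp
    with not_AE_ge_1 show False by simp
  qed
  then show ?thesis by (simp add: emeasure_eq_measure less_le)
qed

text \<open>The supremum may not be attained, but as \<open>Q \<ge> 0\<close> the mass on \<open>M = 1\<close> increases with the exponent, so
  its being below \<open>1\<close> at a larger exponent is inherited by \<open>v\<close>.\<close>

lemma crit_exponent_below:
  assumes v: "ereal v < crit_exponent P M Q v\<^sub>Q" "0 < v"
    and fin: "\<And>v::real. ereal v < v\<^sub>Q \<Longrightarrow> exp_moment P Q v < \<infinity>"
  shows "exp_moment P Q v < \<infinity>"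
    and "(\<integral>\<^sup>+\<omega>. ennreal (exp (v * Q \<omega>)) * indicator {\<omega> \<in> space P. M \<omega> = 1} \<omega> \<partial>P) < 1"
proof -
  show "exp_moment P Q v < \<infinity>" using v by (intro fin) (simp add: crit_exponent_def)
  obtain w where "v < w" and w:
      "(\<integral>\<^sup>+\<omega>. ennreal (exp (w * Q \<omega>)) * indicator {\<omega> \<in> space P. M \<omega> = 1} \<omega> \<partial>P) < 1"
    using v by (auto simp: crit_exponent_def less_SUP_iff)
  have "(\<integral>\<^sup>+\<omega>. ennreal (exp (v * Q \<omega>)) * indicator {\<omega> \<in> space P. M \<omega> = 1} \<omega> \<partial>P) \<le>
      (\<integral>\<^sup>+\<omega>. ennreal (exp (w * Q \<omega>)) * indicator {\<omega> \<in> space P. M \<omega> = 1} \<omega> \<partial>P)"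
  proof (rule nn_integral_mono_AE)
    show "AE \<omega> in P. ennreal (exp (v * Q \<omega>)) * indicator {\<omega> \<in> space P. M \<omega> = 1} \<omega> \<le>
        ennreal (exp (w * Q \<omega>)) * indicator {\<omega> \<in> space P. M \<omega> = 1} \<omega>"
      using AE_range
      by eventually_elim
        (use \<open>v < w\<close> in \<open>auto intro!: mult_right_mono ennreal_leI simp: mult_right_mono\<close>)
  qed
  with w show "(\<integral>\<^sup>+\<omega>. ennreal (exp (v * Q \<omega>)) * indicator {\<omega> \<in> space P. M \<omega> = 1} \<omega> \<partial>P) < 1"
    by (rule order.strict_trans1[rotated])
qed

lemma crit_exponent_above:
  assumes v: "crit_exponent P M Q v\<^sub>Q < ereal v" and "0 < v\<^sub>Q"
    and inf: "\<And>v::real. v\<^sub>Q < ereal v \<Longrightarrow> exp_moment P Q v = \<infinity>"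
  shows "0 \<le> v"
    and "exp_moment P Q v = \<infinity> \<or>
      1 \<le> (\<integral>\<^sup>+\<omega>. ennreal (exp (v * Q \<omega>)) * indicator {\<omega> \<in> space P. M \<omega> = 1} \<omega> \<partial>P)"
proof -
  let ?V = "{v::real. 0 \<le> v \<and>
      (\<integral>\<^sup>+\<omega>. ennreal (exp (v * Q \<omega>)) * indicator {\<omega> \<in> space P. M \<omega> = 1} \<omega> \<partial>P) < 1}"
  have "ereal 0 \<le> (SUP v\<in>?V. ereal v)"
    using slice_at_0 by (intro SUP_upper) simp
  then have "0 \<le> crit_exponent P M Q v\<^sub>Q"
    using \<open>0 < v\<^sub>Q\<close> by (simp add: crit_exponent_def zero_ereal_def)
  then show v0: "0 \<le> v" using v by (metis ereal_less_eq(5) less_le order_trans)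
  have "v \<notin> ?V" if "(SUP v\<in>?V. ereal v) < ereal v"
    using that SUP_upper[of v ?V ereal] by (auto simp: not_less[symmetric])
  then show "exp_moment P Q v = \<infinity> \<or>
      1 \<le> (\<integral>\<^sup>+\<omega>. ennreal (exp (v * Q \<omega>)) * indicator {\<omega> \<in> space P. M \<omega> = 1} \<omega> \<partial>P)"
    using v v0 inf by (auto simp: crit_exponent_def min_less_iff_disj not_less)
qed

end

section \<open>The phase transition\<close>

theorem theorem2p1:
  fixes P :: "'a measure"
    and M Q R\<^sub>0 :: "'a \<Rightarrow> real"
    and Ms Qs Rs :: "nat \<Rightarrow> 'a \<Rightarrow> real"
    and v\<^sub>Q :: ereal
  assumes "prob_space P"
    and "M \<in> borel_measurable P" and "Q \<in> borel_measurable P"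
    and "\<P>(\<omega> in P. 0 \<le> Q \<omega> \<and> 0 \<le> M \<omega> \<and> M \<omega> \<le> 1) = 1"
    and "\<P>(\<omega> in P. M \<omega> < 1) > 0"
    and "0 < v\<^sub>Q"
    and "\<And>v::real. ereal v < v\<^sub>Q \<Longrightarrow> exp_moment P Q v < \<infinity>"
    and "\<And>v::real. v\<^sub>Q < ereal v \<Longrightarrow> exp_moment P Q v = \<infinity>"
    and "prob_space.indep_vars P (\<lambda>_. borel \<Otimes>\<^sub>M borel) (\<lambda>n \<omega>. (Ms n \<omega>, Qs n \<omega>)) UNIV"
    and "\<And>n. distr P (borel \<Otimes>\<^sub>M borel) (\<lambda>\<omega>. (Ms n \<omega>, Qs n \<omega>)) =
              distr P (borel \<Otimes>\<^sub>M borel) (\<lambda>\<omega>. (M \<omega>, Q \<omega>))"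
    and "indep_rvs P borel R\<^sub>0
           (\<Pi>\<^sub>M n\<in>UNIV. borel \<Otimes>\<^sub>M borel) (\<lambda>\<omega> n. (Ms n \<omega>, Qs n \<omega>))"
    and "AE \<omega> in P. 0 \<le> R\<^sub>0 \<omega>"
    and "\<And>v::real. exp_moment P R\<^sub>0 v < \<infinity>"
    and "\<And>\<omega>. \<omega> \<in> space P \<Longrightarrow> Rs 0 \<omega> = R\<^sub>0 \<omega>"
    and "\<And>n \<omega>. \<omega> \<in> space P \<Longrightarrow> Rs (Suc n) \<omega> = Ms n \<omega> * Rs n \<omega> + Qs n \<omega>"
  shows "(\<forall>v::real. ereal v < crit_exponent P M Q v\<^sub>Q \<longrightarrow>
            (SUP n. exp_moment P (Rs n) v) < \<infinity> \<and>
            (\<forall>R. solves_perpetuity P M Q R \<longrightarrow> exp_moment P R v < \<infinity>)) \<and>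
         (\<forall>v::real. crit_exponent P M Q v\<^sub>Q < ereal v \<longrightarrow>
            (SUP n. exp_moment P (Rs n) v) = \<infinity> \<and>
            (\<forall>R. solves_perpetuity P M Q R \<longrightarrow> exp_moment P R v = \<infinity>))"
proof (intro conjI allI impI)
  interpret prob_space P by fact
  note [measurable] = assms(2,3)
  interpret contractive_perpetuity P M Q
  proof
    have "{\<omega> \<in> space P. 0 \<le> Q \<omega> \<and> 0 \<le> M \<omega> \<and> M \<omega> \<le> 1} \<in> events" by measurable
    from prob_Collect_eq_1[OF this] assms(4)
    show "AE \<omega> in P. 0 \<le> Q \<omega> \<and> 0 \<le> M \<omega> \<and> M \<omega> \<le> 1" by simp
  qed (use assms(2,3,5) in auto)
  have [measurable]: "R\<^sub>0 \<in> borel_measurable P" using assms(11) by (simp add: indep_rvs_def)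
  let ?e = "\<lambda>v r::real. ennreal (exp (v * r))"
  have chain: "exp_moment P (Rs n) v = (\<integral>\<^sup>+\<omega>. (step ^^ n) (?e v) (R\<^sub>0 \<omega>) \<partial>P)" for n v
    unfolding exp_moment_def
    by (rule nn_integral_chain[OF assms(9,10,11,14,15), where f = "?e v"]) auto
  {
    fix v :: real
    assume v: "ereal v < crit_exponent P M Q v\<^sub>Q"
    obtain b B where b: "0 \<le> b" "b < 1" and B: "0 \<le> B"
      and drift: "\<And>r. 0 \<le> r \<Longrightarrow> step (?e v) r \<le> ennreal (b * exp (v * r) + (1 - b) * B)"
    proof (cases "0 < v")
      case True
      note below = crit_exponent_below[OF v True assms(7)]
      show thesis
        by (rule upper_drift_exp[OF True below]) (assumption | rule that)+
    next
      case False
      (* Here exp (v * r) is at most 1 on the half-line, which is the drift inequality with b = 0. *)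
      then show thesis
        using that[of 0 1] upper_drift_exp_nonpos[of v] by simp
    qed
    show "exp_moment P R v < \<infinity>" if "solves_perpetuity P M Q R" for R
      using stationary_exp_moment_le[OF that b(1) less_imp_le[OF b(2)] B drift]
      by (auto intro: order.strict_trans1)
    have "exp_moment P (Rs n) v \<le> exp_moment P R\<^sub>0 v + ennreal B" for n
    proof -
      have "exp_moment P (Rs n) v \<le> (\<integral>\<^sup>+\<omega>. ?e v (R\<^sub>0 \<omega>) + ennreal B \<partial>P)"
        unfolding chain
      proof (rule nn_integral_mono_AE)
        show "AE \<omega> in P. (step ^^ n) (?e v) (R\<^sub>0 \<omega>) \<le> ?e v (R\<^sub>0 \<omega>) + ennreal B"
          using assms(12)
        proof eventually_elim
          case (elim \<omega>)
          have "(step ^^ n) (?e v) (R\<^sub>0 \<omega>) \<le> ennreal (b ^ n * exp (v * R\<^sub>0 \<omega>) + (1 - b ^ n) * B)"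
            by (rule step_funpow_upper_drift[where W = "\<lambda>r. exp (v * r)", OF _ _ b(1) less_imp_le[OF b(2)] B drift])
              (use elim in simp_all)
          also have "\<dots> \<le> ennreal (exp (v * R\<^sub>0 \<omega>) + B)"
            using b B by (intro ennreal_leI add_mono mult_left_le_one_le) (auto intro: power_le_one)
          finally show ?case using B by simp
        qed
      qed
      also have "\<dots> = exp_moment P R\<^sub>0 v + ennreal B"
        by (simp add: nn_integral_add exp_moment_def emeasure_space_1)
      finally show ?thesis .
    qed
    then have "(SUP n. exp_moment P (Rs n) v) \<le> exp_moment P R\<^sub>0 v + ennreal B"
      by (rule SUP_least)
    also have "\<dots> < \<infinity>" using assms(13)[of v] by simp
    finally show "(SUP n. exp_moment P (Rs n) v) < \<infinity>" .
  next
    fix v :: real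
    assume v: "crit_exponent P M Q v\<^sub>Q < ereal v"
    let ?p = "ennreal \<P>(\<omega> in P. M \<omega> < 1)"
    note above = crit_exponent_above[OF v assms(6,8)]
    have drift: "?e v r + ?p \<le> step (?e v) r" if "0 \<le> r" for r
      using above(2) lower_drift_exp_slice[OF above(1) that] step_exp_eq_infinity[OF above(1) that]
      by auto
    have diverge: "of_nat n * ?p \<le> (\<integral>\<^sup>+\<omega>. (step ^^ n) (?e v) (X \<omega>) \<partial>P)"
      if "AE \<omega> in P. 0 \<le> X \<omega>" for n X
    proof -
      have "(\<integral>\<^sup>+\<omega>. of_nat n * ?p \<partial>P) \<le> (\<integral>\<^sup>+\<omega>. (step ^^ n) (?e v) (X \<omega>) \<partial>P)"
      proof (rule nn_integral_mono_AE)
        show "AE \<omega> in P. of_nat n * ?p \<le> (step ^^ n) (?e v) (X \<omega>)"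
          using that
        proof eventually_elim
          case (elim \<omega>)
          have "?e v (X \<omega>) + of_nat n * ?p \<le> (step ^^ n) (?e v) (X \<omega>)"
            by (rule step_funpow_lower_drift) (use drift elim in auto)
          then show ?case by (rule order_trans[rotated]) simp
        qed
      qed
      then show ?thesis by (simp add: emeasure_space_1)
    qed
    have top: "x = \<infinity>" if "\<And>n. of_nat n * ?p \<le> x" for x
    proof -
      have "(SUP n. of_nat n * ?p) \<le> x" using that by (rule SUP_least)
      moreover have "(SUP n. of_nat n * ?p) = \<top> * ?p"
        by (subst SUP_mult_right_ennreal[symmetric]) (simp add: ennreal_SUP_of_nat_eq_top)
      ultimately show ?thesis using assms(5) by (simp add: ennreal_top_mult top.extremum_unique)
    qed
    show "(SUP n. exp_moment P (Rs n) v) = \<infinity>"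
      by (rule top) (auto intro!: SUP_upper2 diverge assms(12) simp: chain)
    show "exp_moment P R v = \<infinity>" if R: "solves_perpetuity P M Q R" for R
    proof (rule top)
      show "of_nat n * ?p \<le> exp_moment P R v" for n
        unfolding exp_moment_def
        by (subst nn_integral_stationary[OF R, where n = n])
          (auto intro!: diverge stationary_nonneg R)
    qed
  }
qed

end
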